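(* Let $G$ and $H$ be two finite simple graphs such that $\delta(G)\ge1$. Then $$\left\lceil\frac{(\Delta(G)+1)\,|V(H)|}{2}\right\rceil\le\chi_{\times2}(G\circ H)\le\chi_{\times2}(G)\,|V(H)|.$$ Moreover, these bounds are sharp, i.e. each of the two inequalities holds with equality for some such graphs $G$ and $H$.
   Context: $\delta(G)$ and $\Delta(G)$ are the minimum and maximum degrees of $G$, and $N[v]=N(v)\cup\{v\}$ is the closed neighborhood of $v$. A set $B\subseteq V(G)$ is a $2$-limited packing ($2$LP set) if $|B\cap N[v]|\le 2$ for every $v\in V(G)$; $\chi_{\times2}(G)$ is the minimum number of sets in a partition of $V(G)$ into $2$LP sets. The lexicographic product $G\circ H$ has vertex set $V(G)\times V(H)$, and two vertices $(g,h)$ and $(g',h')$ are adjacent if either $gg'\in E(G)$, or $g=g'$ and $hh'\in E(H)$. Graphs have at least one vertex. *)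

theory Defs
  imports Complex_Main "HOL-Library.Disjoint_Sets" "Graph_Theory.Pair_Digraph"
begin

text \<open>
  Finite simple graphs are represented by the locale predicate \<open>pair_graph\<close>: finite, loop-free
  pair digraphs with a symmetric arc relation, each edge \<open>{u, v}\<close> being given by the two arcs
  \<open>(u, v)\<close> and \<open>(v, u)\<close>. That predicate admits the empty vertex set, which is excluded here.
\<close>

definition simple_graph :: "'a pair_pre_digraph \<Rightarrow> bool" where
  "simple_graph G \<longleftrightarrow> pair_graph G \<and> pverts G \<noteq> {}"

definition nbhd :: "'a pair_pre_digraph \<Rightarrow> 'a \<Rightarrow> 'a set" where
  "nbhd G v = {u \<in> pverts G. (v, u) \<in> parcs G}"

definition closed_nbhd :: "'a pair_pre_digraph \<Rightarrow> 'a \<Rightarrow> 'a set" where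
  "closed_nbhd G v = insert v (nbhd G v)"

text \<open>
  As every edge contributes exactly one arc leaving each of its ends, the degree of a vertex is
  its out-degree. \<open>Min\<close> and \<open>Max\<close> are only meaningful because the vertex set is finite and nonempty.
\<close>

definition min_degree :: "'a pair_pre_digraph \<Rightarrow> nat" where
  "min_degree G = Min (out_degree (with_proj G) ` pverts G)"

definition max_degree :: "'a pair_pre_digraph \<Rightarrow> nat" where
  "max_degree G = Max (out_degree (with_proj G) ` pverts G)"

definition two_limited_packing :: "'a pair_pre_digraph \<Rightarrow> 'a set \<Rightarrow> bool" where
  "two_limited_packing G B \<longleftrightarrow>
     B \<subseteq> pverts G \<and> (\<forall>v \<in> pverts G. card (B \<inter> closed_nbhd G v) \<le> 2)"

text \<open>
  The minimum exists for every finite simple graph, since singletons are 2-limited packings.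
\<close>

definition chi_x2 :: "'a pair_pre_digraph \<Rightarrow> nat" where
  "chi_x2 G = (LEAST k. \<exists>P. partition_on (pverts G) P \<and>
                 (\<forall>B \<in> P. two_limited_packing G B) \<and> card P = k)"

definition lex_product ::
    "'a pair_pre_digraph \<Rightarrow> 'b pair_pre_digraph \<Rightarrow> ('a \<times> 'b) pair_pre_digraph" where
  "lex_product G H = \<lparr> pverts = pverts G \<times> pverts H,
     parcs = {((g, h), (g', h')) | g h g' h'.
       g \<in> pverts G \<and> g' \<in> pverts G \<and> h \<in> pverts H \<and> h' \<in> pverts H \<and>
       ((g, g') \<in> parcs G \<or> g = g' \<and> (h, h') \<in> parcs H)} \<rparr>"

lemma out_degree_eq_card_nbhd:
  assumes "simple_graph G"
  shows "out_degree (with_proj G) v = card (nbhd G v)"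
proof -
  interpret pair_graph G using assms by (simp add: simple_graph_def)
  have "u \<in> pverts G" if "(v, u) \<in> parcs G" for u
    using arc_snd_in_verts[OF that] by simp
  then have "out_arcs (with_proj G) v = Pair v ` nbhd G v"
    by (auto simp: out_arcs_def nbhd_def with_proj_def image_iff)
  then show ?thesis
    by (simp add: out_degree_def card_image inj_on_def)
qed

lemma simple_graph_lex_product:
  assumes "simple_graph G" "simple_graph H"
  shows "simple_graph (lex_product G H)"
proof -
  interpret G: pair_graph G using assms by (simp add: simple_graph_def)
  interpret H: pair_graph H using assms by (simp add: simple_graph_def)
  have symG: "sym (parcs G)" and symH: "sym (parcs H)"
    using G.pair_sym_arcs H.pair_sym_arcs by (simp_all add: symmetric_def)
  have fin: "finite (pverts G \<times> pverts H)" by simp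
  have sub: "parcs (lex_product G H) \<subseteq> (pverts G \<times> pverts H) \<times> (pverts G \<times> pverts H)"
    by (auto simp: lex_product_def)
  have wf: "pair_wf_digraph (lex_product G H)"
    by unfold_locales (auto simp: lex_product_def)
  interpret P: pair_wf_digraph "lex_product G H" by (rule wf)
  have "sym (parcs (lex_product G H))"
    using symG symH by (auto simp: sym_def lex_product_def)
  moreover have "finite (parcs (lex_product G H))"
    using sub fin by (meson finite_SigmaI finite_subset)
  moreover have "fst e \<noteq> snd e" if "e \<in> parcs (lex_product G H)" for e
    using that G.pair_no_loops H.pair_no_loops by (fastforce simp: lex_product_def)
  ultimately have "pair_graph (lex_product G H)"
    by unfold_locales (auto simp: symmetric_def lex_product_def)
  then show ?thesis
    using assms by (auto simp: simple_graph_def lex_product_def)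
qed

end

theory Submission
  imports Defs
begin

text \<open>
  Lower bound. Let \<open>g\<close> be a non-isolated vertex of \<open>G\<close>. A 2-limited packing \<open>B\<close> of the
  lexicographic product meets \<open>N[g] \<times> V(H)\<close> in at most two vertices
  (\<open>two_limited_packing_lex_product_meets_block\<close>), although this set is in general not contained in a
  single closed neighbourhood: every vertex over \<open>g\<close> is adjacent to everything over \<open>N(g)\<close>, and
  vice versa, so if \<open>B\<close> has a vertex in both of these parts, then each of the two vertices
  dominates the other part and leaves room for one vertex there; if \<open>B\<close> avoids one of the parts,
  then any vertex of that part dominates all of \<open>B\<close> in the other one. Hence a partition into
  2-limited packings has at least half as many classes as \<open>N[g] \<times> V(H)\<close> has vertices, and taking
  \<open>g\<close> of maximum degree gives the bound.

  Upper bound. If \<open>B\<close> is a 2-limited packing of \<open>G\<close>, then so is each of its layers \<open>B \<times> {h}\<close> in the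
  product, because neighbourhoods in the product project into closed neighbourhoods of \<open>G\<close>. The
  layers of the classes of an optimal partition of \<open>G\<close> partition the product.

  Sharpness. For \<open>G = K\<^sub>2\<close> and any \<open>H\<close> the two bounds coincide: the whole vertex set of \<open>K\<^sub>2\<close> is a
  2-limited packing, so both are \<open>|V(H)|\<close>. Taking \<open>H = K\<^sub>1\<close> gives an explicit instance for both
  equalities.
\<close>

section \<open>Neighbourhoods and degrees\<close>

lemma finite_pverts:
  assumes "simple_graph G"
  shows "finite (pverts G)"
proof -
  interpret pair_graph G using assms by (simp add: simple_graph_def)
  show ?thesis by simp
qed

lemma nbhd_irrefl:
  assumes "simple_graph G"
  shows "v \<notin> nbhd G v"
proof -
  interpret pair_graph G using assms by (simp add: simple_graph_def)
  show ?thesis using no_loops' by (auto simp: nbhd_def)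
qed

lemma nbhd_sym:
  assumes "simple_graph G" "v \<in> pverts G" "u \<in> nbhd G v"
  shows "v \<in> nbhd G u"
proof -
  interpret pair_graph G using assms by (simp add: simple_graph_def)
  show ?thesis using assms(2,3) arcs_symmetric by (auto simp: nbhd_def)
qed

lemma finite_nbhd: "simple_graph G \<Longrightarrow> finite (nbhd G v)"
  using finite_pverts[of G] by (simp add: nbhd_def)

lemma card_closed_nbhd:
  assumes "simple_graph G"
  shows "card (closed_nbhd G v) = Suc (card (nbhd G v))"
  unfolding closed_nbhd_def using assms by (simp add: finite_nbhd nbhd_irrefl)

lemma max_degree_attained:
  assumes "simple_graph G"
  obtains g where "g \<in> pverts G" "card (nbhd G g) = max_degree G"
proof -
  have "max_degree G \<in> out_degree (with_proj G) ` pverts G"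
    unfolding max_degree_def
    using assms finite_pverts[OF assms] by (intro Max_in) (auto simp: simple_graph_def)
  then show thesis
    using that out_degree_eq_card_nbhd[OF assms] by auto
qed

lemma nbhd_nonempty_if_min_degree:
  assumes "simple_graph G" "min_degree G \<ge> 1" "g \<in> pverts G"
  shows "nbhd G g \<noteq> {}"
proof -
  have "min_degree G \<le> out_degree (with_proj G) g"
    unfolding min_degree_def using assms finite_pverts[OF assms(1)] by (intro Min_le) auto
  then show ?thesis
    using assms out_degree_eq_card_nbhd[OF assms(1)] by auto
qed

section \<open>Neighbourhoods in the lexicographic product\<close>

lemma pverts_lex_product [simp]: "pverts (lex_product G H) = pverts G \<times> pverts H"
  by (simp add: lex_product_def)

lemma nbhd_lex_product:
  assumes "g \<in> pverts G" "h \<in> pverts H"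
  shows "nbhd (lex_product G H) (g, h) = nbhd G g \<times> pverts H \<union> {g} \<times> nbhd H h"
  using assms by (auto simp: nbhd_def lex_product_def)

section \<open>Partitions into 2-limited packings\<close>

lemma chi_x2_le_card:
  assumes "partition_on (pverts G) P" "\<And>B. B \<in> P \<Longrightarrow> two_limited_packing G B"
  shows "chi_x2 G \<le> card P"
  unfolding chi_x2_def by (rule Least_le) (use assms in blast)

text \<open>
  The minimum is attained because the singletons form a partition into 2-limited packings; for an
  empty set of candidates, \<open>LEAST\<close> would be an unspecified number.
\<close>

lemma chi_x2_attained:
  assumes "simple_graph G"
  obtains P where "partition_on (pverts G) P" "\<And>B. B \<in> P \<Longrightarrow> two_limited_packing G B"
    "card P = chi_x2 G"
proof -
  let ?S = "(\<lambda>v. {v}) ` pverts G"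
  have "partition_on (pverts G) ?S"
    by (intro partition_onI) (auto simp: disjnt_def)
  moreover have "two_limited_packing G {v}" if "v \<in> pverts G" for v
  proof -
    have "card ({v} \<inter> X) \<le> 2" for X
      using card_mono[of "{v}" "{v} \<inter> X"] by simp
    then show ?thesis
      using that by (simp add: two_limited_packing_def)
  qed
  ultimately have "\<exists>k P. partition_on (pverts G) P \<and>
      (\<forall>B \<in> P. two_limited_packing G B) \<and> card P = k"
    by blast
  from LeastI_ex[OF this] show thesis
    unfolding chi_x2_def[symmetric] using that by blast
qed

lemma card_le_partition_bound:
  assumes "finite V" "partition_on V P" "S \<subseteq> V"
    and "\<And>B. B \<in> P \<Longrightarrow> card (B \<inter> S) \<le> n"
  shows "card S \<le> n * card P"
proof -
  have "S = (\<Union>B\<in>P. B \<inter> S)"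
    using assms(2,3) by (auto simp: partition_on_def)
  then have "card S \<le> (\<Sum>B\<in>P. card (B \<inter> S))"
    using card_UN_le[OF finite_elements[OF assms(1,2)], of "\<lambda>B. B \<inter> S"] by simp
  also have "\<dots> \<le> n * card P"
    using sum_bounded_above[of P "\<lambda>B. card (B \<inter> S)" n] assms(4) by (simp add: mult.commute)
  finally show ?thesis .
qed

section \<open>The lower bound\<close>

text \<open>
  The two parts of the block are completely joined to each other, so a vertex of either part
  counts all of \<open>B\<close> in the other part, and also itself if it lies in \<open>B\<close>.
\<close>

lemma two_limited_packing_lex_product_meets_block:
  assumes G: "simple_graph G" and H: "simple_graph H"
    and g: "g \<in> pverts G" "nbhd G g \<noteq> {}"
    and B: "two_limited_packing (lex_product G H) B"
  shows "card (B \<inter> closed_nbhd G g \<times> pverts H) \<le> 2"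
proof -
  define F where "F = B \<inter> {g} \<times> pverts H"
  define D where "D = B \<inter> nbhd G g \<times> pverts H"
  have nbhd_sub: "nbhd G g \<subseteq> pverts G"
    by (auto simp: nbhd_def)
  obtain h where h: "h \<in> pverts H"
    using H by (auto simp: simple_graph_def)
  obtain g' where g': "g' \<in> nbhd G g"
    using g by blast
  have "finite B"
    using B finite_pverts[OF simple_graph_lex_product[OF G H]] finite_subset
    unfolding two_limited_packing_def by blast
  then have fin: "finite F" "finite D"
    by (simp_all add: F_def D_def)
  have count: "card X \<le> 2"
    if "(x, y) \<in> pverts G \<times> pverts H" "X \<subseteq> B \<inter> closed_nbhd (lex_product G H) (x, y)" for x y X
  proof -
    have "card X \<le> card (B \<inter> closed_nbhd (lex_product G H) (x, y))"
      using that(2) \<open>finite B\<close> by (intro card_mono) auto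
    also have "\<dots> \<le> 2"
      using B that(1) unfolding two_limited_packing_def pverts_lex_product by blast
    finally show ?thesis .
  qed
  have D_dominated: "D \<subseteq> B \<inter> closed_nbhd (lex_product G H) (g, y)" if "y \<in> pverts H" for y
    using that g by (auto simp: D_def closed_nbhd_def nbhd_lex_product)
  have F_dominated: "F \<subseteq> B \<inter> closed_nbhd (lex_product G H) (x, y)"
    if "x \<in> nbhd G g" "y \<in> pverts H" for x y
  proof -
    have "x \<in> pverts G" "g \<in> nbhd G x"
      using that nbhd_sub nbhd_sym[OF G g(1)] by auto
    then show ?thesis
      using that by (auto simp: F_def closed_nbhd_def nbhd_lex_product)
  qed
  have split: "B \<inter> closed_nbhd G g \<times> pverts H = F \<union> D"
    by (auto simp: F_def D_def closed_nbhd_def)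
  show ?thesis
  proof (cases "F = {} \<or> D = {}")
    case True
    have "card D \<le> 2"
      using count[OF _ D_dominated[OF h]] g h by simp
    moreover have "card F \<le> 2"
      using count[OF _ F_dominated[OF g' h]] g' nbhd_sub h by auto
    ultimately show ?thesis
      using True split by auto
  next
    case False
    obtain y where y: "(g, y) \<in> F"
      using False by (auto simp: F_def)
    obtain x z where xz: "(x, z) \<in> D"
      using False by auto
    have "card (insert (g, y) D) \<le> 2"
      using D_dominated[of y] y g by (intro count[of g y]) (auto simp: F_def closed_nbhd_def)
    moreover have "(g, y) \<notin> D"
      using nbhd_irrefl[OF G] by (auto simp: D_def)
    ultimately have "card D \<le> 1"
      using fin by simp
    have "card (insert (x, z) F) \<le> 2"
      using F_dominated[of x z] xz nbhd_sub
      by (intro count[of x z]) (auto simp: D_def closed_nbhd_def)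
    moreover have "(x, z) \<notin> F"
      using nbhd_irrefl[OF G] xz by (auto simp: D_def F_def)
    ultimately have "card F \<le> 1"
      using fin by simp
    with \<open>card D \<le> 1\<close> show ?thesis
      using card_Un_le[of F D] split by simp
  qed
qed

lemma chi_x2_lex_product_lower:
  assumes G: "simple_graph G" and H: "simple_graph H" and "min_degree G \<ge> 1"
  shows "(max_degree G + 1) * card (pverts H) \<le> 2 * chi_x2 (lex_product G H)"
proof -
  note GH = simple_graph_lex_product[OF G H]
  obtain g where g: "g \<in> pverts G" "card (nbhd G g) = max_degree G"
    using max_degree_attained[OF G] by blast
  obtain P where P: "partition_on (pverts (lex_product G H)) P"
    "\<And>B. B \<in> P \<Longrightarrow> two_limited_packing (lex_product G H) B"
    "card P = chi_x2 (lex_product G H)"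
    using chi_x2_attained[OF GH] by blast
  have "closed_nbhd G g \<times> pverts H \<subseteq> pverts (lex_product G H)"
    using g by (auto simp: closed_nbhd_def nbhd_def)
  then have "card (closed_nbhd G g \<times> pverts H) \<le> 2 * card P"
    using P nbhd_nonempty_if_min_degree[OF G assms(3) g(1)]
    by (intro card_le_partition_bound[OF finite_pverts[OF GH] P(1)]
        two_limited_packing_lex_product_meets_block[OF G H g(1)])
  then show ?thesis
    using g P by (simp add: card_cartesian_product card_closed_nbhd[OF G])
qed

section \<open>The upper bound\<close>

lemma two_limited_packing_layer:
  assumes G: "simple_graph G" and B: "two_limited_packing G B" and "h \<in> pverts H"
  shows "two_limited_packing (lex_product G H) (B \<times> {h})"
proof -
  have "card (B \<times> {h} \<inter> closed_nbhd (lex_product G H) (x, y)) \<le> 2"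
    if xy: "x \<in> pverts G" "y \<in> pverts H" for x y
  proof -
    have "finite (B \<inter> closed_nbhd G x)"
      using finite_nbhd[OF G] by (simp add: closed_nbhd_def)
    moreover have "B \<times> {h} \<inter> closed_nbhd (lex_product G H) (x, y)
        \<subseteq> (B \<inter> closed_nbhd G x) \<times> {h}"
      using xy by (auto simp: closed_nbhd_def nbhd_lex_product)
    ultimately have "card (B \<times> {h} \<inter> closed_nbhd (lex_product G H) (x, y))
        \<le> card ((B \<inter> closed_nbhd G x) \<times> {h})"
      by (intro card_mono) auto
    also have "\<dots> \<le> 2"
      using B xy by (simp add: two_limited_packing_def card_cartesian_product)
    finally show ?thesis .
  qed
  then show ?thesis
    using B assms(3) by (auto simp: two_limited_packing_def)
qed

lemma chi_x2_lex_product_upper: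
  assumes G: "simple_graph G" and H: "simple_graph H"
  shows "chi_x2 (lex_product G H) \<le> chi_x2 G * card (pverts H)"
proof -
  obtain P where P: "partition_on (pverts G) P"
    "\<And>B. B \<in> P \<Longrightarrow> two_limited_packing G B" "card P = chi_x2 G"
    using chi_x2_attained[OF G] by blast
  define Q where "Q = (\<lambda>(B, h). B \<times> {h}) ` (P \<times> pverts H)"
  have "partition_on (pverts (lex_product G H)) Q"
  proof (rule partition_onI)
    show "\<Union> Q = pverts (lex_product G H)"
      using partition_onD1[OF P(1)] by (auto simp: Q_def)
    show "{} \<notin> Q"
      using partition_onD3[OF P(1)] by (auto simp: Q_def eq_commute[of "{}"])
    show "disjnt p q" if "p \<in> Q" "q \<in> Q" "p \<noteq> q" for p q
    proof -
      obtain B h C k where pq: "p = B \<times> {h}" "q = C \<times> {k}" "B \<in> P" "C \<in> P"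
        using \<open>p \<in> Q\<close> \<open>q \<in> Q\<close> by (auto simp: Q_def)
      have "h \<noteq> k \<or> B \<inter> C = {}"
        using \<open>p \<noteq> q\<close> pq disjointD[OF partition_onD2[OF P(1)], of B C] by auto
      then show ?thesis
        using pq by (auto simp: disjnt_def)
    qed
  qed
  moreover have "two_limited_packing (lex_product G H) B" if "B \<in> Q" for B
    using that by (auto simp: Q_def intro!: two_limited_packing_layer[OF G] P(2))
  ultimately have "chi_x2 (lex_product G H) \<le> card Q"
    by (rule chi_x2_le_card)
  also have "\<dots> \<le> card (P \<times> pverts H)"
    unfolding Q_def using finite_elements[OF finite_pverts[OF G] P(1)] finite_pverts[OF H]
    by (intro card_image_le) simp
  finally show ?thesis
    using P(3) by (simp add: card_cartesian_product)
qed

section \<open>Sharpness on products with the complete graph on two vertices\<close>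

definition K1 :: "nat pair_pre_digraph" where
  "K1 = \<lparr> pverts = {0}, parcs = {} \<rparr>"

definition K2 :: "nat pair_pre_digraph" where
  "K2 = \<lparr> pverts = {0, 1}, parcs = {(0, 1), (1, 0)} \<rparr>"

lemma simple_graph_K1: "simple_graph K1"
proof -
  have wf: "pair_wf_digraph K1"
    by unfold_locales (auto simp: K1_def)
  interpret pair_wf_digraph K1 by (rule wf)
  have "pair_graph K1"
    by unfold_locales (auto simp: K1_def symmetric_def sym_def)
  then show ?thesis
    by (simp add: simple_graph_def K1_def)
qed

lemma simple_graph_K2: "simple_graph K2"
proof -
  have wf: "pair_wf_digraph K2"
    by unfold_locales (auto simp: K2_def)
  interpret pair_wf_digraph K2 by (rule wf)
  have "pair_graph K2"
    by unfold_locales (auto simp: K2_def symmetric_def sym_def)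
  then show ?thesis
    by (simp add: simple_graph_def K2_def)
qed

lemma degree_K2:
  shows "min_degree K2 = 1" "max_degree K2 = 1"
proof -
  have "nbhd K2 0 = {1}" "nbhd K2 1 = {0}"
    by (auto simp: nbhd_def K2_def)
  then have "out_degree (with_proj K2) ` pverts K2 = {1}"
    unfolding out_degree_eq_card_nbhd[OF simple_graph_K2]
    by (auto simp: K2_def)
  then show "min_degree K2 = 1" "max_degree K2 = 1"
    by (simp_all add: min_degree_def max_degree_def)
qed

lemma chi_x2_K2_le: "chi_x2 K2 \<le> 1"
proof -
  have "partition_on (pverts K2) {pverts K2}"
    by (intro partition_onI) (auto simp: K2_def)
  moreover have "two_limited_packing K2 (pverts K2)"
  proof -
    have "card (pverts K2 \<inter> X) \<le> 2" for X
      using card_mono[of "pverts K2" "pverts K2 \<inter> X"] by (simp add: K2_def)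
    then show ?thesis
      by (simp add: two_limited_packing_def)
  qed
  ultimately show ?thesis
    using chi_x2_le_card[of K2 "{pverts K2}"] by simp
qed

text \<open>
  The lower bound is \<open>\<lceil>2 |V(H)| / 2\<rceil>\<close> and the upper one at most \<open>1 \<cdot> |V(H)|\<close>, so nothing about the
  structure of the product has to be computed.
\<close>

lemma chi_x2_K2_lex_product:
  assumes "simple_graph H"
  shows "chi_x2 (lex_product K2 H) = card (pverts H)"
    and "chi_x2 (lex_product K2 H) = chi_x2 K2 * card (pverts H)"
proof -
  have "card (pverts H) \<le> chi_x2 (lex_product K2 H)"
    using chi_x2_lex_product_lower[OF simple_graph_K2 assms] by (simp add: degree_K2)
  moreover have "chi_x2 (lex_product K2 H) \<le> chi_x2 K2 * card (pverts H)"
    using chi_x2_lex_product_upper[OF simple_graph_K2 assms] .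
  moreover have "chi_x2 K2 * card (pverts H) \<le> card (pverts H)"
    using mult_le_mono1[OF chi_x2_K2_le, of "card (pverts H)"] by simp
  ultimately show "chi_x2 (lex_product K2 H) = card (pverts H)"
    and "chi_x2 (lex_product K2 H) = chi_x2 K2 * card (pverts H)"
    by linarith+
qed

section \<open>The bounds and their sharpness\<close>

theorem theorem3p6:
  shows "(\<forall>(G :: 'a pair_pre_digraph) (H :: 'b pair_pre_digraph).
            simple_graph G \<and> simple_graph H \<and> min_degree G \<ge> 1 \<longrightarrow>
              \<lceil>real ((max_degree G + 1) * card (pverts H)) / 2\<rceil> \<le> int (chi_x2 (lex_product G H)) \<and>
              chi_x2 (lex_product G H) \<le> chi_x2 G * card (pverts H)) \<and>
         (\<exists>(G :: nat pair_pre_digraph) (H :: nat pair_pre_digraph).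
            simple_graph G \<and> simple_graph H \<and> min_degree G \<ge> 1 \<and>
              \<lceil>real ((max_degree G + 1) * card (pverts H)) / 2\<rceil> = int (chi_x2 (lex_product G H))) \<and>
         (\<exists>(G :: nat pair_pre_digraph) (H :: nat pair_pre_digraph).
            simple_graph G \<and> simple_graph H \<and> min_degree G \<ge> 1 \<and>
              chi_x2 (lex_product G H) = chi_x2 G * card (pverts H))"
proof (intro conjI allI impI)
  fix G :: "'a pair_pre_digraph" and H :: "'b pair_pre_digraph"
  assume asm: "simple_graph G \<and> simple_graph H \<and> min_degree G \<ge> 1"
  then have "(max_degree G + 1) * card (pverts H) \<le> 2 * chi_x2 (lex_product G H)"
    using chi_x2_lex_product_lower by blast
  then have "real ((max_degree G + 1) * card (pverts H)) \<le> real (2 * chi_x2 (lex_product G H))"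
    by (rule of_nat_mono)
  then show "\<lceil>real ((max_degree G + 1) * card (pverts H)) / 2\<rceil> \<le> int (chi_x2 (lex_product G H))"
    unfolding ceiling_le_iff by simp
  show "chi_x2 (lex_product G H) \<le> chi_x2 G * card (pverts H)"
    using asm chi_x2_lex_product_upper by blast
next
  have "\<lceil>real ((max_degree K2 + 1) * card (pverts K1)) / 2\<rceil> = int (chi_x2 (lex_product K2 K1))"
    by (simp add: degree_K2 chi_x2_K2_lex_product(1)[OF simple_graph_K1])
  then show "\<exists>(G :: nat pair_pre_digraph) (H :: nat pair_pre_digraph).
      simple_graph G \<and> simple_graph H \<and> min_degree G \<ge> 1 \<and>
        \<lceil>real ((max_degree G + 1) * card (pverts H)) / 2\<rceil> = int (chi_x2 (lex_product G H))"
    using simple_graph_K1 simple_graph_K2 degree_K2(1) by (metis order_refl)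
  show "\<exists>(G :: nat pair_pre_digraph) (H :: nat pair_pre_digraph).
      simple_graph G \<and> simple_graph H \<and> min_degree G \<ge> 1 \<and>
        chi_x2 (lex_product G H) = chi_x2 G * card (pverts H)"
    using simple_graph_K1 simple_graph_K2 degree_K2(1)
      chi_x2_K2_lex_product(2)[OF simple_graph_K1] by (metis order_refl)
qed

end
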